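(* Let $n\ge 2$ and let $A$ be an LM$_n$-algebra. The lattice $\mathcal{CO}_M(X(A))$ of all closed, open and modal subsets of $X(A)$ is isomorphic to the lattice of Boolean congruences of $A$, via $G\mapsto\{(a,b)\in A\times A:\sigma_A(b)\triangle\sigma_A(a)\subseteq G\}$.
   Context: An LM$_n$-algebra is an algebra $\langle A,\vee,\wedge,0,1,\{\phi_i\}_{i=1}^{n-1},\{\overline{\phi}_i\}_{i=1}^{n-1}\rangle$ with $\langle A,\vee,\wedge,0,1\rangle$ a bounded distributive lattice such that for all $i,j\in\{1,\dots,n-1\}$, $x,y\in A$: $\phi_i$ is a bounded lattice endomorphism; $\phi_i x\vee\overline{\phi}_i x=1$, $\phi_i x\wedge\overline{\phi}_i x=0$; $\phi_i\phi_j x=\phi_j x$; $i\le j$ implies $\phi_i x\le\phi_j x$; $\phi_i x=\phi_i y$ for all $i$ implies $x=y$. A Boolean congruence is a congruence having a complement in the lattice of all congruences of $A$. $X(A)$ is the set of prime filters ordered by inclusion, with subbasis $\sigma_A(a)=\{P:a\in P\}$, $X(A)\setminus\sigma_A(a)$; $f_i^A(P)=\phi_i^{-1}(P)$. $Y$ is modal if $Y=(f_i^A)^{-1}(Y)$ for all $i$. *)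

theory Defs
  imports "HOL-Algebra.Complete_Lattice" "HOL-Analysis.Abstract_Topology"
begin

text \<open>
  The lattice reduct of the algebra is a type \<open>'a\<close> of classes \<open>bounded_lattice\<close> and
  \<open>distrib_lattice\<close> (these classes allow \<open>0 = 1\<close>). Its operations are written with the
  qualifiers \<open>sup_class\<close> and \<open>inf_class\<close>, since HOL-Algebra uses the short
  names for operations of order structures. The families of unary operations are functions of an
  index, constrained only for indices in \<open>{1..n - 1}\<close>.
\<close>

locale LM_algebra =
  fixes n :: nat
    and \<phi> :: "nat \<Rightarrow> 'a::{bounded_lattice, distrib_lattice} \<Rightarrow> 'a"
    and \<phi>bar :: "nat \<Rightarrow> 'a \<Rightarrow> 'a"
  assumes phi_sup: "i \<in> {1..n - 1} \<Longrightarrow> \<phi> i (sup_class.sup x y) = sup_class.sup (\<phi> i x) (\<phi> i y)"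
    and phi_inf: "i \<in> {1..n - 1} \<Longrightarrow> \<phi> i (inf_class.inf x y) = inf_class.inf (\<phi> i x) (\<phi> i y)"
    and phi_bot: "i \<in> {1..n - 1} \<Longrightarrow> \<phi> i bot_class.bot = bot_class.bot"
    and phi_top: "i \<in> {1..n - 1} \<Longrightarrow> \<phi> i top_class.top = top_class.top"
    and phi_sup_phibar: "i \<in> {1..n - 1} \<Longrightarrow> sup_class.sup (\<phi> i x) (\<phi>bar i x) = top_class.top"
    and phi_inf_phibar: "i \<in> {1..n - 1} \<Longrightarrow> inf_class.inf (\<phi> i x) (\<phi>bar i x) = bot_class.bot"
    and phi_phi: "\<lbrakk>i \<in> {1..n - 1}; j \<in> {1..n - 1}\<rbrakk> \<Longrightarrow> \<phi> i (\<phi> j x) = \<phi> j x"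
    and phi_mono: "\<lbrakk>i \<in> {1..n - 1}; j \<in> {1..n - 1}; i \<le> j\<rbrakk> \<Longrightarrow> \<phi> i x \<le> \<phi> j x"
    and phi_determination: "(\<And>i. i \<in> {1..n - 1} \<Longrightarrow> \<phi> i x = \<phi> i y) \<Longrightarrow> x = y"

text \<open>Prime filters are proper.\<close>

definition prime_filters :: "'a::{bounded_lattice, distrib_lattice} set set" where
  "prime_filters = {P. P \<noteq> {} \<and> P \<noteq> UNIV \<and>
     (\<forall>a\<in>P. \<forall>b. a \<le> b \<longrightarrow> b \<in> P) \<and>
     (\<forall>a\<in>P. \<forall>b\<in>P. inf_class.inf a b \<in> P) \<and>
     (\<forall>a b. sup_class.sup a b \<in> P \<longrightarrow> a \<in> P \<or> b \<in> P)}"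

definition \<sigma> :: "'a::{bounded_lattice, distrib_lattice} \<Rightarrow> 'a set set" where
  "\<sigma> a = {P \<in> prime_filters. a \<in> P}"

text \<open>The topology of \<open>X(A)\<close>. Its order plays no role for closed, open and modal sets.\<close>

definition spectrum :: "'a::{bounded_lattice, distrib_lattice} set topology" where
  "spectrum = topology_generated_by (range \<sigma> \<union> range (\<lambda>a. prime_filters - \<sigma> a))"

lemma topspace_spectrum: "topspace spectrum = prime_filters"
  by (auto simp: spectrum_def \<sigma>_def)

definition spectrum_map ::
    "(nat \<Rightarrow> 'a \<Rightarrow> 'a) \<Rightarrow> nat \<Rightarrow> 'a::{bounded_lattice, distrib_lattice} set \<Rightarrow> 'a set" where
  "spectrum_map \<phi> i P = \<phi> i -` P"

definition modal ::
    "nat \<Rightarrow> (nat \<Rightarrow> 'a \<Rightarrow> 'a) \<Rightarrow> 'a::{bounded_lattice, distrib_lattice} set set \<Rightarrow> bool" where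
  "modal n \<phi> Y \<longleftrightarrow> (\<forall>i\<in>{1..n - 1}. Y = {P \<in> topspace spectrum. spectrum_map \<phi> i P \<in> Y})"

definition clopen_modal ::
    "nat \<Rightarrow> (nat \<Rightarrow> 'a \<Rightarrow> 'a) \<Rightarrow> 'a::{bounded_lattice, distrib_lattice} set set set" where
  "clopen_modal n \<phi> = {Y. closedin spectrum Y \<and> openin spectrum Y \<and> modal n \<phi> Y}"

definition congruence ::
    "nat \<Rightarrow> (nat \<Rightarrow> 'a \<Rightarrow> 'a) \<Rightarrow> (nat \<Rightarrow> 'a \<Rightarrow> 'a)
      \<Rightarrow> 'a::{bounded_lattice, distrib_lattice} rel \<Rightarrow> bool" where
  "congruence n \<phi> \<phi>bar \<theta> \<longleftrightarrow> equiv UNIV \<theta> \<and>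
     (\<forall>a b c d. (a, b) \<in> \<theta> \<longrightarrow> (c, d) \<in> \<theta> \<longrightarrow>
        (sup_class.sup a c, sup_class.sup b d) \<in> \<theta> \<and> (inf_class.inf a c, inf_class.inf b d) \<in> \<theta>) \<and>
     (\<forall>i\<in>{1..n - 1}. \<forall>a b. (a, b) \<in> \<theta> \<longrightarrow>
        (\<phi> i a, \<phi> i b) \<in> \<theta> \<and> (\<phi>bar i a, \<phi>bar i b) \<in> \<theta>)"

definition inclusion_order :: "'b set set \<Rightarrow> 'b set gorder" where
  "inclusion_order S = \<lparr>carrier = S, eq = (=), le = (\<subseteq>)\<rparr>"

definition congruence_lattice ::
    "nat \<Rightarrow> (nat \<Rightarrow> 'a \<Rightarrow> 'a) \<Rightarrow> (nat \<Rightarrow> 'a \<Rightarrow> 'a)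
      \<Rightarrow> 'a::{bounded_lattice, distrib_lattice} rel gorder" where
  "congruence_lattice n \<phi> \<phi>bar = inclusion_order {\<theta>. congruence n \<phi> \<phi>bar \<theta>}"

lemma partial_order_inclusion_order: "partial_order (inclusion_order S)"
  by unfold_locales (auto simp: inclusion_order_def)

lemma complete_lattice_congruence_lattice:
  "complete_lattice (congruence_lattice n \<phi> \<phi>bar)" (is "complete_lattice ?L")
proof -
  interpret partial_order ?L
    unfolding congruence_lattice_def by (rule partial_order_inclusion_order)
  show ?thesis
  proof (rule complete_lattice_criterion1)
    have "congruence n \<phi> \<phi>bar UNIV"
      by (auto simp: congruence_def equiv_def refl_on_def sym_def trans_def)
    then show "\<exists>g. greatest ?L g (carrier ?L)"
      by (intro exI[of _ UNIV]) (auto simp: greatest_def congruence_lattice_def inclusion_order_def)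
  next
    fix C assume C: "C \<subseteq> carrier ?L" "C \<noteq> {}"
    then have cong: "congruence n \<phi> \<phi>bar \<theta>" if "\<theta> \<in> C" for \<theta>
      using that by (auto simp: congruence_lattice_def inclusion_order_def)
    have "equiv UNIV (\<Inter>C)"
    proof (rule equivI)
      show "\<Inter>C \<subseteq> UNIV \<times> UNIV" by simp
      show "refl (\<Inter>C)"
        using cong by (auto simp: congruence_def equiv_def refl_on_def)
      show "sym (\<Inter>C)"
        using cong unfolding congruence_def equiv_def sym_def by blast
      show "trans (\<Inter>C)"
        using cong unfolding congruence_def equiv_def trans_def by blast
    qed
    then have "congruence n \<phi> \<phi>bar (\<Inter>C)"
      using cong unfolding congruence_def by blast
    then show "\<exists>i. greatest ?L i (Lower ?L C)"
      using C by (intro exI[of _ "\<Inter>C"])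
        (auto simp: greatest_def Lower_def congruence_lattice_def inclusion_order_def)
  qed
qed

definition boolean_congruences ::
    "nat \<Rightarrow> (nat \<Rightarrow> 'a \<Rightarrow> 'a) \<Rightarrow> (nat \<Rightarrow> 'a \<Rightarrow> 'a)
      \<Rightarrow> 'a::{bounded_lattice, distrib_lattice} rel set" where
  "boolean_congruences n \<phi> \<phi>bar =
     (let L = congruence_lattice n \<phi> \<phi>bar in
       {\<theta> \<in> carrier L. \<exists>\<psi>\<in>carrier L. \<theta> \<sqinter>\<^bsub>L\<^esub> \<psi> = \<bottom>\<^bsub>L\<^esub> \<and> \<theta> \<squnion>\<^bsub>L\<^esub> \<psi> = \<top>\<^bsub>L\<^esub>})"

definition sublattice :: "'b set \<Rightarrow> 'b gorder \<Rightarrow> bool" where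
  "sublattice S L \<longleftrightarrow> lattice L \<and> S \<noteq> {} \<and> S \<subseteq> carrier L \<and>
     (\<forall>x\<in>S. \<forall>y\<in>S. x \<squnion>\<^bsub>L\<^esub> y \<in> S \<and> x \<sqinter>\<^bsub>L\<^esub> y \<in> S)"

text \<open>\<^const>\<open>join_pres\<close> and \<^const>\<open>meet_pres\<close> include that both structures are lattices.\<close>

definition lattice_iso :: "'b gorder \<Rightarrow> 'c gorder \<Rightarrow> ('b \<Rightarrow> 'c) \<Rightarrow> bool" where
  "lattice_iso L M h \<longleftrightarrow>
     bij_betw h (carrier L) (carrier M) \<and> join_pres L M h \<and> meet_pres L M h"

end

theory Submission
  imports Defs
begin

text \<open>
  Call \<open>z\<close> central if every \<open>\<phi> i\<close> fixes it. The closed, open and modal sets are exactly the sets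
  \<open>\<sigma> z\<close> with \<open>z\<close> central: if \<open>P\<close> lies in such a set \<open>G\<close>, then so does its image under the first
  spectral map; a basic neighbourhood \<open>\<sigma> a - \<sigma> b\<close> of this image inside \<open>G\<close> pulls back to
  \<open>\<sigma> (\<phi> 1 a \<and> \<phi>bar 1 b)\<close>, a central neighbourhood of \<open>P\<close> inside \<open>G\<close>. The same holds for the
  complement of \<open>G\<close>, and the prime filter theorem replaces the two covers by single central
  elements with join \<open>1\<close>.

  Conversely, let \<open>\<theta>\<close> and \<open>\<psi>\<close> be complementary congruences. The central elements congruent to
  \<open>0\<close> modulo \<open>\<theta>\<close> cover an open modal set whose congruence contains \<open>\<theta>\<close>, because \<open>a\<close> and \<open>b\<close> are
  determined by the central elements \<open>\<phi> i a\<close> and \<open>\<phi> i b\<close>. So the sets of \<open>\<theta>\<close> and \<open>\<psi>\<close> together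
  cover the spectrum, which gives central \<open>c\<close>, \<open>d\<close> with join \<open>1\<close>, where \<open>c\<close> is congruent to \<open>0\<close>
  modulo \<open>\<theta>\<close> and \<open>d\<close> modulo \<open>\<psi>\<close>. Then \<open>\<theta>\<close> is the congruence of \<open>\<sigma> c\<close>.
\<close>

notation sup_class.sup (infixl \<open>\<curlyvee>\<close> 65)
notation inf_class.inf (infixl \<open>\<curlywedge>\<close> 70)
notation bot_class.bot (\<open>\<zero>\<close>)
notation top_class.top (\<open>\<one>\<close>)

subsection \<open>Families of sets ordered by inclusion\<close>

text \<open>The operation \<open>\<squnion>\<close> is a choice among least upper bounds, so
  antisymmetry is what pins it to \<open>J\<close>. The bound \<open>J\<close> is left general
  because the join of two congruences need not be their union; the first conclusion serves the
  lattice axioms.\<close>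

lemma join_inclusion_order:
  assumes "J \<in> S" "A \<subseteq> J" "B \<subseteq> J" "\<And>C. \<lbrakk>C \<in> S; A \<subseteq> C; B \<subseteq> C\<rbrakk> \<Longrightarrow> J \<subseteq> C"
    and "A \<in> S" "B \<in> S"
  shows "least (inclusion_order S) J (Upper (inclusion_order S) {A, B})"
    and "A \<squnion>\<^bsub>inclusion_order S\<^esub> B = J"
proof -
  interpret partial_order "inclusion_order S" by (rule partial_order_inclusion_order)
  show "least (inclusion_order S) J (Upper (inclusion_order S) {A, B})"
    using assms by (auto simp: least_def Upper_def inclusion_order_def)
  then show "A \<squnion>\<^bsub>inclusion_order S\<^esub> B = J"
    unfolding join_def sup_def by (metis least_unique someI)
qed

lemma meet_inclusion_order:
  assumes "M \<in> S" "M \<subseteq> A" "M \<subseteq> B" "\<And>C. \<lbrakk>C \<in> S; C \<subseteq> A; C \<subseteq> B\<rbrakk> \<Longrightarrow> C \<subseteq> M"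
    and "A \<in> S" "B \<in> S"
  shows "greatest (inclusion_order S) M (Lower (inclusion_order S) {A, B})"
    and "A \<sqinter>\<^bsub>inclusion_order S\<^esub> B = M"
proof -
  interpret partial_order "inclusion_order S" by (rule partial_order_inclusion_order)
  show "greatest (inclusion_order S) M (Lower (inclusion_order S) {A, B})"
    using assms by (auto simp: greatest_def Lower_def inclusion_order_def)
  then show "A \<sqinter>\<^bsub>inclusion_order S\<^esub> B = M"
    unfolding meet_def inf_def by (metis greatest_unique someI)
qed

lemma lattice_inclusion_order:
  assumes "\<And>A B. \<lbrakk>A \<in> S; B \<in> S\<rbrakk> \<Longrightarrow> \<exists>J\<in>S. A \<subseteq> J \<and> B \<subseteq> J \<and> (\<forall>C\<in>S. A \<subseteq> C \<longrightarrow> B \<subseteq> C \<longrightarrow> J \<subseteq> C)"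
    and "\<And>A B. \<lbrakk>A \<in> S; B \<in> S\<rbrakk> \<Longrightarrow> \<exists>M\<in>S. M \<subseteq> A \<and> M \<subseteq> B \<and> (\<forall>C\<in>S. C \<subseteq> A \<longrightarrow> C \<subseteq> B \<longrightarrow> C \<subseteq> M)"
  shows "lattice (inclusion_order S)"
proof -
  interpret partial_order "inclusion_order S" by (rule partial_order_inclusion_order)
  have carrier: "carrier (inclusion_order S) = S" by (simp add: inclusion_order_def)
  show ?thesis
  proof unfold_locales
    fix A B assume "A \<in> carrier (inclusion_order S)" "B \<in> carrier (inclusion_order S)"
    then have AB: "A \<in> S" "B \<in> S" by (simp_all add: carrier)
    obtain J where "J \<in> S" "A \<subseteq> J" "B \<subseteq> J" "\<forall>C\<in>S. A \<subseteq> C \<longrightarrow> B \<subseteq> C \<longrightarrow> J \<subseteq> C"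
      using assms(1)[OF AB] by blast
    with AB show "\<exists>s. least (inclusion_order S) s (Upper (inclusion_order S) {A, B})"
      by (intro exI[of _ J] join_inclusion_order(1)) auto
    obtain M where "M \<in> S" "M \<subseteq> A" "M \<subseteq> B" "\<forall>C\<in>S. C \<subseteq> A \<longrightarrow> C \<subseteq> B \<longrightarrow> C \<subseteq> M"
      using assms(2)[OF AB] by blast
    with AB show "\<exists>s. greatest (inclusion_order S) s (Lower (inclusion_order S) {A, B})"
      by (intro exI[of _ M] meet_inclusion_order(1)) auto
  qed
qed

subsection \<open>Prime filters\<close>

context
  fixes P :: "'a::{bounded_lattice, distrib_lattice} set"
  assumes P: "P \<in> prime_filters"
begin

lemma prime_filter_up: "\<lbrakk>a \<in> P; a \<le> b\<rbrakk> \<Longrightarrow> b \<in> P"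
  using P unfolding prime_filters_def by blast

lemma prime_filter_inf: "a \<curlywedge> b \<in> P \<longleftrightarrow> a \<in> P \<and> b \<in> P"
  using P prime_filter_up[of "a \<curlywedge> b"] unfolding prime_filters_def by auto

lemma prime_filter_sup: "a \<curlyvee> b \<in> P \<longleftrightarrow> a \<in> P \<or> b \<in> P"
  using P prime_filter_up[of _ "a \<curlyvee> b"] unfolding prime_filters_def by auto

lemma prime_filter_top: "\<one> \<in> P"
  using P prime_filter_up[of _ "\<one>"] unfolding prime_filters_def by auto

lemma prime_filter_bot: "\<zero> \<notin> P"
proof
  assume "\<zero> \<in> P"
  then have "P = UNIV" using prime_filter_up[of "\<zero>"] by auto
  with P show False unfolding prime_filters_def by auto
qed

end

lemmas prime_filter_simps =
  prime_filter_inf prime_filter_sup prime_filter_top prime_filter_bot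

lemma prime_filterI:
  assumes "\<one> \<in> P" "\<zero> \<notin> P" "\<And>a b. \<lbrakk>a \<in> P; a \<le> b\<rbrakk> \<Longrightarrow> b \<in> P"
    and "\<And>a b. \<lbrakk>a \<in> P; b \<in> P\<rbrakk> \<Longrightarrow> a \<curlywedge> b \<in> P" "\<And>a b. a \<curlyvee> b \<in> P \<Longrightarrow> a \<in> P \<or> b \<in> P"
  shows "P \<in> prime_filters"
  using assms unfolding prime_filters_def by blast

text \<open>This is the prime filter theorem for an ideal \<open>D\<close>. Zorn's lemma gives a
  filter maximal among those that contain \<open>a\<close> and miss \<open>D\<close>; distributivity
  makes it prime.\<close>

lemma prime_filter_exists:
  fixes D :: "'a::{bounded_lattice, distrib_lattice} set"
  assumes bot: "\<zero> \<in> D" and down: "\<And>x y. \<lbrakk>y \<in> D; x \<le> y\<rbrakk> \<Longrightarrow> x \<in> D"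
    and join: "\<And>x y. \<lbrakk>x \<in> D; y \<in> D\<rbrakk> \<Longrightarrow> x \<curlyvee> y \<in> D" and "a \<notin> D"
  shows "\<exists>P\<in>prime_filters. a \<in> P \<and> P \<inter> D = {}"
proof -
  define \<F> where "\<F> = {F. a \<in> F \<and> (\<forall>x\<in>F. \<forall>y. x \<le> y \<longrightarrow> y \<in> F) \<and>
    (\<forall>x\<in>F. \<forall>y\<in>F. x \<curlywedge> y \<in> F) \<and> F \<inter> D = {}}"
  have "\<exists>M\<in>\<F>. \<forall>X\<in>\<F>. M \<subseteq> X \<longrightarrow> X = M"
  proof (rule subset_Zorn_nonempty)
    \<comment> \<open>The principal filter of \<open>a\<close> misses \<open>D\<close> because
      \<open>D\<close> is closed downwards.\<close>
    have "{x. a \<le> x} \<in> \<F>"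
      using \<open>a \<notin> D\<close> down unfolding \<F>_def by (auto intro: order_trans)
    then show "\<F> \<noteq> {}" by blast
  next
    fix \<C> assume ne: "\<C> \<noteq> {}" and "subset.chain \<F> \<C>"
    then have sub: "\<C> \<subseteq> \<F>" and chain: "\<And>X Y. \<lbrakk>X \<in> \<C>; Y \<in> \<C>\<rbrakk> \<Longrightarrow> X \<subseteq> Y \<or> Y \<subseteq> X"
      by (auto simp: subset_chain_def)
    have "x \<curlywedge> y \<in> \<Union>\<C>" if xy: "x \<in> \<Union>\<C>" "y \<in> \<Union>\<C>" for x y
    proof -
      obtain X Y where XY: "X \<in> \<C>" "Y \<in> \<C>" "x \<in> X" "y \<in> Y" using xy by blast
      then obtain Z where Z: "Z \<in> \<C>" "x \<in> Z" "y \<in> Z" using chain[OF XY(1,2)] by blast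
      then have "Z \<in> \<F>" using sub by blast
      with Z show ?thesis unfolding \<F>_def by blast
    qed
    moreover have "a \<in> \<Union>\<C>" "\<forall>x\<in>\<Union>\<C>. \<forall>y. x \<le> y \<longrightarrow> y \<in> \<Union>\<C>" "\<Union>\<C> \<inter> D = {}"
      using ne sub unfolding \<F>_def by blast+
    ultimately show "\<Union>\<C> \<in> \<F>" unfolding \<F>_def by blast
  qed
  then obtain M where M: "M \<in> \<F>" and max: "\<And>X. \<lbrakk>X \<in> \<F>; M \<subseteq> X\<rbrakk> \<Longrightarrow> X = M" by blast
  from M have aM: "a \<in> M" and up: "\<And>x y. \<lbrakk>x \<in> M; x \<le> y\<rbrakk> \<Longrightarrow> y \<in> M"
    and meet: "\<And>x y. \<lbrakk>x \<in> M; y \<in> M\<rbrakk> \<Longrightarrow> x \<curlywedge> y \<in> M" and disj: "M \<inter> D = {}"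
    unfolding \<F>_def by blast+
  have ext: "\<exists>m\<in>M. m \<curlywedge> x \<in> D" if "x \<notin> M" for x
  proof (rule ccontr)
    assume no: "\<not> ?thesis"
    \<comment> \<open>This is the filter generated by \<open>M\<close> and \<open>x\<close>. If it
      missed \<open>D\<close>, maximality would put \<open>x\<close> into \<open>M\<close>.\<close>
    define X where "X = {y. \<exists>m\<in>M. m \<curlywedge> x \<le> y}"
    have MX: "M \<subseteq> X" unfolding X_def using inf.cobounded1 by blast
    have "y \<curlywedge> z \<in> X" if yz: "y \<in> X" "z \<in> X" for y z
    proof -
      obtain m k where mk: "m \<in> M" "k \<in> M" "m \<curlywedge> x \<le> y" "k \<curlywedge> x \<le> z"
        using yz unfolding X_def by blast
      have "(m \<curlywedge> k) \<curlywedge> x \<le> y" "(m \<curlywedge> k) \<curlywedge> x \<le> z"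
        by (meson mk(3,4) inf_mono inf.cobounded1 inf.cobounded2 order_refl order_trans)+
      then show ?thesis unfolding X_def using meet[OF mk(1,2)] by auto
    qed
    moreover have "X \<inter> D = {}" using no down unfolding X_def by blast
    moreover have "\<forall>y\<in>X. \<forall>z. y \<le> z \<longrightarrow> z \<in> X" unfolding X_def by (auto intro: order_trans)
    moreover have "a \<in> X" using MX aM by blast
    ultimately have "X \<in> \<F>" by (simp add: \<F>_def)
    then have "X = M" using MX by (rule max)
    moreover have "x \<in> X" unfolding X_def using aM inf.cobounded2 by blast
    ultimately show False using \<open>x \<notin> M\<close> by blast
  qed
  have "M \<in> prime_filters"
  proof (rule prime_filterI)
    show "\<one> \<in> M" using up[OF aM] by simp
    show "\<zero> \<notin> M" using bot disj by blast
    fix x y assume xy: "x \<curlyvee> y \<in> M"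
    show "x \<in> M \<or> y \<in> M"
    proof (rule ccontr)
      assume "\<not> ?thesis"
      then obtain m k where mk: "m \<in> M" "k \<in> M" "m \<curlywedge> x \<in> D" "k \<curlywedge> y \<in> D" using ext by blast
      \<comment> \<open>The meet of the two witnesses works for \<open>x\<close> and
        \<open>y\<close> at once, so distributivity can combine them into one for
        \<open>x \<curlyvee> y\<close>.\<close>
      have "(m \<curlywedge> k) \<curlywedge> x \<in> D" "(m \<curlywedge> k) \<curlywedge> y \<in> D"
        by (rule down[OF mk(3)] down[OF mk(4)], simp add: le_infI1)+
      then have "(m \<curlywedge> k) \<curlywedge> (x \<curlyvee> y) \<in> D" by (simp add: inf_sup_distrib1 join)
      moreover have "(m \<curlywedge> k) \<curlywedge> (x \<curlyvee> y) \<in> M" using mk xy meet by blast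
      ultimately show False using disj by blast
    qed
  qed (use up meet in blast)+
  with aM disj show ?thesis by blast
qed

lemma \<sigma>_sup: "\<sigma> (a \<curlyvee> b) = \<sigma> a \<union> \<sigma> b"
  by (auto simp: \<sigma>_def prime_filter_simps)

lemma \<sigma>_inf: "\<sigma> (a \<curlywedge> b) = \<sigma> a \<inter> \<sigma> b"
  by (auto simp: \<sigma>_def prime_filter_simps)

lemma \<sigma>_top: "\<sigma> \<one> = prime_filters"
  by (auto simp: \<sigma>_def prime_filter_simps)

lemma \<sigma>_bot: "\<sigma> \<zero> = {}"
  by (auto simp: \<sigma>_def prime_filter_simps)

lemma \<sigma>_subset: "\<sigma> a \<subseteq> prime_filters"
  by (auto simp: \<sigma>_def)

text \<open>If \<open>a\<close> is not below \<open>b\<close>, it lies outside the principal ideal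
  of \<open>b\<close>, and the prime filter theorem separates the two. Equations in the algebra can
  therefore be checked on prime filters.\<close>

lemma \<sigma>_subset_iff: "\<sigma> a \<subseteq> \<sigma> b \<longleftrightarrow> a \<le> b"
proof
  assume sub: "\<sigma> a \<subseteq> \<sigma> b"
  show "a \<le> b"
  proof (rule ccontr)
    assume "\<not> a \<le> b"
    then have "\<exists>P\<in>prime_filters. a \<in> P \<and> P \<inter> {x. x \<le> b} = {}"
      by (intro prime_filter_exists) auto
    with sub show False unfolding \<sigma>_def by blast
  qed
qed (auto simp: \<sigma>_def intro: prime_filter_up)

lemma \<sigma>_eq_iff: "\<sigma> a = \<sigma> b \<longleftrightarrow> a = b"
  by (metis \<sigma>_subset_iff antisym order_refl)

text \<open>This takes the place of compactness. If no such join were \<open>\<one>\<close>, the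
  ideal \<open>D\<close> generated by \<open>I\<close> and \<open>J\<close> would be proper, and a
  prime filter missing \<open>D\<close> would escape the cover. Only closure under joins is asked of
  \<open>I\<close> and \<open>J\<close>, since sets of central elements need not be closed
  downwards.\<close>

lemma prime_filter_cover:
  fixes I J :: "'a::{bounded_lattice, distrib_lattice} set"
  assumes cover: "prime_filters \<subseteq> (\<Union>z\<in>I. \<sigma> z) \<union> (\<Union>w\<in>J. \<sigma> w)"
    and I: "\<zero> \<in> I" "\<And>x y. \<lbrakk>x \<in> I; y \<in> I\<rbrakk> \<Longrightarrow> x \<curlyvee> y \<in> I"
    and J: "\<zero> \<in> J" "\<And>x y. \<lbrakk>x \<in> J; y \<in> J\<rbrakk> \<Longrightarrow> x \<curlyvee> y \<in> J"
  shows "\<exists>z\<in>I. \<exists>w\<in>J. z \<curlyvee> w = \<one>"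
proof (rule ccontr)
  assume no: "\<not> ?thesis"
  define D where "D = {x. \<exists>z\<in>I. \<exists>w\<in>J. x \<le> z \<curlyvee> w}"
  have "\<exists>P\<in>prime_filters. \<one> \<in> P \<and> P \<inter> D = {}"
  proof (rule prime_filter_exists)
    show "\<zero> \<in> D" using I(1) J(1) by (auto simp: D_def)
    show "\<one> \<notin> D" using no by (auto simp: D_def top_unique)
    show "x \<in> D" if "y \<in> D" "x \<le> y" for x y
      using that unfolding D_def by (auto intro: order_trans)
    show "x \<curlyvee> y \<in> D" if xy: "x \<in> D" "y \<in> D" for x y
    proof -
      obtain z w z' w' where *: "z \<in> I" "w \<in> J" "x \<le> z \<curlyvee> w" "z' \<in> I" "w' \<in> J" "y \<le> z' \<curlyvee> w'"
        using xy unfolding D_def by blast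
      have "x \<curlyvee> y \<le> (z \<curlyvee> z') \<curlyvee> (w \<curlyvee> w')"
        using sup_mono[OF *(3,6)] by (simp add: sup.left_commute sup.assoc)
      with * I J show ?thesis unfolding D_def by blast
    qed
  qed
  then obtain P where P: "P \<in> prime_filters" "P \<inter> D = {}" by blast
  have "I \<subseteq> D" "J \<subseteq> D" unfolding D_def using I(1) J(1) sup.cobounded1 sup.cobounded2 by blast+
  moreover obtain x where "x \<in> I \<union> J" "x \<in> P"
    using P(1) cover unfolding \<sigma>_def by blast
  ultimately show False using P(2) by blast
qed

subsection \<open>Clopen modal sets and central elements\<close>

lemma openin_\<sigma>: "openin spectrum (\<sigma> a)"
  unfolding spectrum_def by (rule topology_generated_by_Basis) auto

lemma closedin_\<sigma>: "closedin spectrum (\<sigma> a)"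
proof -
  have "openin spectrum (prime_filters - \<sigma> a)"
    unfolding spectrum_def by (rule topology_generated_by_Basis) auto
  then show ?thesis by (simp add: closedin_def topspace_spectrum \<sigma>_subset)
qed

text \<open>The differences \<open>\<sigma> a - \<sigma> b\<close> are closed under binary
  intersection and include the subbasis, with \<open>b = \<zero>\<close> for
  \<open>\<sigma> a\<close> and \<open>a = \<one>\<close> for the complement of
  \<open>\<sigma> b\<close>.\<close>

lemma spectrum_basis:
  assumes "openin spectrum U" "P \<in> U"
  shows "\<exists>a b. P \<in> \<sigma> a - \<sigma> b \<and> \<sigma> a - \<sigma> b \<subseteq> U"
proof -
  have "generate_topology_on (range \<sigma> \<union> range (\<lambda>a. prime_filters - \<sigma> a)) U"
    using assms(1) unfolding spectrum_def by (rule openin_topology_generated_by)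
  then show ?thesis using assms(2)
  proof (induction rule: generate_topology_on.induct)
    case (Int U V)
    then obtain a b c d where "P \<in> \<sigma> a - \<sigma> b" "\<sigma> a - \<sigma> b \<subseteq> U" "P \<in> \<sigma> c - \<sigma> d" "\<sigma> c - \<sigma> d \<subseteq> V"
      by blast
    then show ?case by (intro exI[of _ "a \<curlywedge> c"] exI[of _ "b \<curlyvee> d"]) (auto simp: \<sigma>_inf \<sigma>_sup)
  next
    case (Basis U)
    then consider a where "U = \<sigma> a" | b where "U = prime_filters - \<sigma> b" by blast
    then show ?case
    proof cases
      case 1 with Basis show ?thesis by (intro exI[of _ a] exI[of _ "\<zero>"]) (auto simp: \<sigma>_bot)
    next
      case 2 with Basis show ?thesis by (intro exI[of _ "\<one>"] exI[of _ b]) (auto simp: \<sigma>_top)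
    qed
  qed blast+
qed

text \<open>The map of the theorem under a name. It is the kernel of restricting each
  \<open>\<sigma> a\<close> to the complement of \<open>G\<close>.\<close>

definition cong_of :: "'a::{bounded_lattice, distrib_lattice} set set \<Rightarrow> 'a rel" where
  "cong_of G = {(a, b). sym_diff (\<sigma> b) (\<sigma> a) \<subseteq> G}"

lemma cong_of_iff:
  "(a, b) \<in> cong_of G \<longleftrightarrow> (\<forall>P\<in>prime_filters. P \<notin> G \<longrightarrow> (a \<in> P \<longleftrightarrow> b \<in> P))"
  by (auto simp: cong_of_def \<sigma>_def)

lemma cong_of_Int: "cong_of (G \<inter> H) = cong_of G \<inter> cong_of H"
  by (auto simp: cong_of_def)

lemma cong_of_mono: "G \<subseteq> H \<Longrightarrow> cong_of G \<subseteq> cong_of H"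
  by (auto simp: cong_of_def)

lemma cong_of_empty: "cong_of {} = (Id :: 'a::{bounded_lattice, distrib_lattice} rel)"
proof -
  have "sym_diff (\<sigma> b) (\<sigma> a) \<subseteq> {} \<longleftrightarrow> \<sigma> a = \<sigma> b" for a b :: 'a by blast
  then show ?thesis by (auto simp: cong_of_def \<sigma>_eq_iff)
qed

text \<open>Two sets agree outside \<open>\<sigma> c\<close> exactly when their unions with it
  coincide, and injectivity of \<open>\<sigma>\<close> makes this an equation. Arguments about
  \<open>cong_of (\<sigma> c)\<close> thereby become algebraic.\<close>

lemma cong_of_\<sigma>_iff: "(a, b) \<in> cong_of (\<sigma> c) \<longleftrightarrow> a \<curlyvee> c = b \<curlyvee> c"
proof -
  have "(a, b) \<in> cong_of (\<sigma> c) \<longleftrightarrow> \<sigma> (a \<curlyvee> c) = \<sigma> (b \<curlyvee> c)"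
    unfolding cong_of_def \<sigma>_sup by blast
  then show ?thesis by (simp only: \<sigma>_eq_iff)
qed

lemma complement_unique:
  fixes x y z :: "'a::{bounded_lattice, distrib_lattice}"
  assumes "x \<curlyvee> y = \<one>" "x \<curlywedge> y = \<zero>" "x \<curlyvee> z = \<one>" "x \<curlywedge> z = \<zero>"
  shows "y = z"
  using assms by (metis inf_commute inf_sup_distrib1 inf_top.right_neutral)

context LM_algebra
begin

text \<open>By uniqueness of complements and the determination principle, these are exactly the
  complemented elements, that is, the Boolean centre.\<close>

definition central :: "'a set" where
  "central = {z. \<forall>i\<in>{1..n - 1}. \<phi> i z = z}"

lemma phi_central: "i \<in> {1..n - 1} \<Longrightarrow> \<phi> i x \<in> central"
  by (simp add: central_def phi_phi)

text \<open>The endomorphism \<open>\<phi> j\<close> fixes \<open>\<phi> i x\<close> and preserves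
  complements, so it must fix the unique complement \<open>\<phi>bar i x\<close> as well.\<close>

lemma phibar_central:
  assumes "i \<in> {1..n - 1}" shows "\<phi>bar i x \<in> central"
proof -
  have "\<phi> j (\<phi>bar i x) = \<phi>bar i x" if j: "j \<in> {1..n - 1}" for j
  proof (rule complement_unique[of "\<phi> i x"])
    have "\<phi> i x \<curlyvee> \<phi> j (\<phi>bar i x) = \<phi> j (\<phi> i x \<curlyvee> \<phi>bar i x)"
      by (simp only: phi_sup[OF j] phi_phi[OF j assms])
    then show "\<phi> i x \<curlyvee> \<phi> j (\<phi>bar i x) = \<one>" by (simp only: phi_sup_phibar[OF assms] phi_top[OF j])
    have "\<phi> i x \<curlywedge> \<phi> j (\<phi>bar i x) = \<phi> j (\<phi> i x \<curlywedge> \<phi>bar i x)"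
      by (simp only: phi_inf[OF j] phi_phi[OF j assms])
    then show "\<phi> i x \<curlywedge> \<phi> j (\<phi>bar i x) = \<zero>" by (simp only: phi_inf_phibar[OF assms] phi_bot[OF j])
  qed (use assms phi_sup_phibar phi_inf_phibar in auto)
  then show ?thesis by (simp add: central_def)
qed

lemma central_closed:
  "\<zero> \<in> central" "x \<in> central \<Longrightarrow> y \<in> central \<Longrightarrow> x \<curlyvee> y \<in> central"
  "x \<in> central \<Longrightarrow> y \<in> central \<Longrightarrow> x \<curlywedge> y \<in> central"
  by (auto simp: central_def phi_bot phi_sup phi_inf)

lemma phi_vimage_prime_filter:
  assumes "i \<in> {1..n - 1}" "P \<in> prime_filters"
  shows "\<phi> i -` P \<in> prime_filters"
proof (rule prime_filterI)
  fix a b assume "a \<in> \<phi> i -` P" "a \<le> b"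
  \<comment> \<open>The axiom \<open>phi_mono\<close> concerns the index; monotonicity in the
    argument comes from preservation of joins.\<close>
  moreover from \<open>a \<le> b\<close> have "\<phi> i b = \<phi> i a \<curlyvee> \<phi> i b"
    by (metis phi_sup[OF assms(1)] sup.absorb2)
  ultimately show "b \<in> \<phi> i -` P" by (metis assms(2) prime_filter_sup vimage_eq)
qed (use assms in \<open>auto simp: phi_sup phi_inf phi_bot phi_top prime_filter_simps\<close>)

text \<open>Containment in \<open>prime_filters\<close> is read off from a single index, so there
  has to be one: with no index at all, every set would count as modal.\<close>

lemma modal_iff:
  "modal n \<phi> G \<longleftrightarrow>
    G \<subseteq> prime_filters \<and> (\<forall>i\<in>{1..n - 1}. \<forall>P\<in>prime_filters. P \<in> G \<longleftrightarrow> \<phi> i -` P \<in> G)"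
  if "2 \<le> n"
proof -
  have "(1::nat) \<in> {1..n - 1}" using that by auto
  then show ?thesis unfolding modal_def topspace_spectrum spectrum_map_def by blast
qed

lemma phibar_mem_iff:
  assumes "i \<in> {1..n - 1}" "P \<in> prime_filters"
  shows "\<phi>bar i a \<in> P \<longleftrightarrow> \<phi> i a \<notin> P"
  using phi_sup_phibar[OF assms(1), of a] phi_inf_phibar[OF assms(1), of a] assms(2)
  by (metis prime_filter_simps)

lemma modal_\<sigma>:
  assumes "2 \<le> n" "z \<in> central"
  shows "modal n \<phi> (\<sigma> z)"
  unfolding modal_iff[OF assms(1)]
  using assms(2) phi_vimage_prime_filter by (auto simp: \<sigma>_def central_def)

lemma modal_Union:
  assumes "2 \<le> n" "I \<subseteq> central"
  shows "modal n \<phi> (\<Union>z\<in>I. \<sigma> z)"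
  using modal_\<sigma>[OF assms(1)] assms(2) unfolding modal_iff[OF assms(1)] by blast

lemma modal_Un: "\<lbrakk>2 \<le> n; modal n \<phi> G; modal n \<phi> H\<rbrakk> \<Longrightarrow> modal n \<phi> (G \<union> H)"
  by (auto simp: modal_iff)

lemma modal_compl: "\<lbrakk>2 \<le> n; modal n \<phi> G\<rbrakk> \<Longrightarrow> modal n \<phi> (prime_filters - G)"
  by (simp add: modal_iff phi_vimage_prime_filter)

lemma open_modal_cover:
  assumes n: "2 \<le> n" and "openin spectrum G" "modal n \<phi> G"
  shows "G = (\<Union>z\<in>{z\<in>central. \<sigma> z \<subseteq> G}. \<sigma> z)"
proof
  show "G \<subseteq> (\<Union>z\<in>{z\<in>central. \<sigma> z \<subseteq> G}. \<sigma> z)"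
  proof
    fix P assume "P \<in> G"
    have 1: "1 \<in> {1..n - 1}" using n by auto
    from assms(3) have sub: "G \<subseteq> prime_filters"
      and mod: "\<And>Q. Q \<in> prime_filters \<Longrightarrow> Q \<in> G \<longleftrightarrow> \<phi> 1 -` Q \<in> G"
      unfolding modal_iff[OF n] using 1 by blast+
    have P: "P \<in> prime_filters" using \<open>P \<in> G\<close> sub by blast
    then have "\<phi> 1 -` P \<in> G" using mod \<open>P \<in> G\<close> by blast
    then obtain a b where ab: "\<phi> 1 -` P \<in> \<sigma> a - \<sigma> b" "\<sigma> a - \<sigma> b \<subseteq> G"
      using spectrum_basis[OF assms(2)] by blast
    \<comment> \<open>The element \<open>\<phi>bar 1 b\<close> represents the complement of
      \<open>\<sigma> (\<phi> 1 b)\<close>, so \<open>\<sigma> z\<close> is the preimage of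
      \<open>\<sigma> a - \<sigma> b\<close> under the first spectral map.\<close>
    define z where "z = \<phi> 1 a \<curlywedge> \<phi>bar 1 b"
    have z: "z \<in> central"
      unfolding z_def by (intro central_closed phi_central phibar_central 1)
    have mem: "Q \<in> \<sigma> z \<longleftrightarrow> \<phi> 1 -` Q \<in> \<sigma> a - \<sigma> b" if "Q \<in> prime_filters" for Q
      using that phi_vimage_prime_filter[OF 1 that]
      by (auto simp: z_def \<sigma>_def prime_filter_simps phibar_mem_iff[OF 1, unfolded One_nat_def])
    \<comment> \<open>Modality brings a filter \<open>Q\<close> itself into \<open>G\<close> once
      its image is there.\<close>
    have "\<sigma> z \<subseteq> G" using mem mod ab(2) \<sigma>_subset by blast
    moreover have "P \<in> \<sigma> z" using mem[OF P] ab(1) by blast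
    ultimately show "P \<in> (\<Union>z\<in>{z\<in>central. \<sigma> z \<subseteq> G}. \<sigma> z)" using z by blast
  qed
qed blast

lemma clopen_modal_eq:
  assumes n: "2 \<le> n"
  shows "clopen_modal n \<phi> = \<sigma> ` central"
proof
  show "\<sigma> ` central \<subseteq> clopen_modal n \<phi>"
    by (auto simp: clopen_modal_def openin_\<sigma> closedin_\<sigma> modal_\<sigma>[OF n])
  show "clopen_modal n \<phi> \<subseteq> \<sigma> ` central"
  proof
    fix G assume "G \<in> clopen_modal n \<phi>"
    then have G: "openin spectrum G" "openin spectrum (prime_filters - G)" "modal n \<phi> G"
      by (auto simp: clopen_modal_def closedin_def topspace_spectrum)
    define H where "H = prime_filters - G"
    have sub: "G \<subseteq> prime_filters" using G(3) by (simp add: modal_iff[OF n])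
    define I where "I = (\<lambda>U. {z\<in>central. \<sigma> z \<subseteq> U})"
    have I: "\<zero> \<in> I U" "\<And>x y. \<lbrakk>x \<in> I U; y \<in> I U\<rbrakk> \<Longrightarrow> x \<curlyvee> y \<in> I U" for U
      by (auto simp: I_def central_closed \<sigma>_bot \<sigma>_sup)
    have "G = (\<Union>z\<in>I G. \<sigma> z)" "H = (\<Union>z\<in>I H. \<sigma> z)"
      unfolding I_def H_def using open_modal_cover[OF n] G modal_compl[OF n G(3)] by simp_all
    then have "prime_filters \<subseteq> (\<Union>z\<in>I G. \<sigma> z) \<union> (\<Union>z\<in>I H. \<sigma> z)" by (auto simp: H_def)
    then obtain z w where zw: "z \<in> I G" "w \<in> I H" "z \<curlyvee> w = \<one>"
      using prime_filter_cover[OF _ I I] by blast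
    have "\<sigma> z \<union> \<sigma> w = prime_filters" using zw(3) by (metis \<sigma>_sup \<sigma>_top)
    \<comment> \<open>The sets \<open>\<sigma> z\<close> and \<open>\<sigma> w\<close> fill the
      spectrum and lie in \<open>G\<close> and its complement respectively, so neither inclusion can
      be strict.\<close>
    then have "G = \<sigma> z" using zw(1,2) sub by (auto simp: I_def H_def)
    then show "G \<in> \<sigma> ` central" using zw(1) by (auto simp: I_def)
  qed
qed

subsection \<open>Boolean congruences\<close>

text \<open>Lattice operations are compatible at each prime filter separately. For
  \<open>\<phi> i\<close>, modality keeps the image of a filter outside \<open>G\<close> outside
  \<open>G\<close>; \<open>\<phi>bar i\<close> follows by complementation. The statement covers
  unions of sets \<open>\<sigma> z\<close> whose closedness is not known.\<close>

lemma congruence_cong_of: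
  assumes "2 \<le> n" "modal n \<phi> G"
  shows "congruence n \<phi> \<phi>bar (cong_of G)"
proof -
  have "\<And>P. \<lbrakk>P \<in> prime_filters; P \<notin> G\<rbrakk> \<Longrightarrow> \<phi> i -` P \<in> prime_filters \<and> \<phi> i -` P \<notin> G"
    if "i \<in> {1..n - 1}" for i
    using assms that phi_vimage_prime_filter[OF that] by (auto simp: modal_iff)
  then have phi: "(\<phi> i a, \<phi> i b) \<in> cong_of G" if "i \<in> {1..n - 1}" "(a, b) \<in> cong_of G" for i a b
    using that unfolding cong_of_iff by (metis vimage_eq)
  then have "(\<phi>bar i a, \<phi>bar i b) \<in> cong_of G" if "i \<in> {1..n - 1}" "(a, b) \<in> cong_of G" for i a b
    using phi[OF that] phibar_mem_iff[OF that(1)] by (simp add: cong_of_iff)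
  moreover have "equiv UNIV (cong_of G)"
    by (auto simp: equiv_def refl_on_def sym_def trans_def cong_of_iff)
  ultimately show ?thesis
    using phi by (auto simp: congruence_def cong_of_iff prime_filter_simps)
qed

text \<open>The class of \<open>\<zero>\<close> cut down to the Boolean centre. For a congruence it
  is closed under joins, as \<open>prime_filter_cover\<close> requires.\<close>

definition central_kernel :: "'a rel \<Rightarrow> 'a set" where
  "central_kernel \<theta> = {c \<in> central. (\<zero>, c) \<in> \<theta>}"

context
  fixes \<theta> assumes \<theta>: "congruence n \<phi> \<phi>bar \<theta>"
begin

lemma congruence_refl: "(a, a) \<in> \<theta>"
  using \<theta> by (simp add: congruence_def equiv_def refl_on_def)

lemma congruence_sym: "(a, b) \<in> \<theta> \<Longrightarrow> (b, a) \<in> \<theta>"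
  using \<theta> unfolding congruence_def equiv_def sym_def by blast

lemma congruence_trans: "\<lbrakk>(a, b) \<in> \<theta>; (b, c) \<in> \<theta>\<rbrakk> \<Longrightarrow> (a, c) \<in> \<theta>"
  using \<theta> unfolding congruence_def equiv_def trans_def by blast

lemma congruence_sup: "\<lbrakk>(a, b) \<in> \<theta>; (c, d) \<in> \<theta>\<rbrakk> \<Longrightarrow> (a \<curlyvee> c, b \<curlyvee> d) \<in> \<theta>"
  using \<theta> unfolding congruence_def by blast

lemma congruence_inf: "\<lbrakk>(a, b) \<in> \<theta>; (c, d) \<in> \<theta>\<rbrakk> \<Longrightarrow> (a \<curlywedge> c, b \<curlywedge> d) \<in> \<theta>"
  using \<theta> unfolding congruence_def by blast

lemma congruence_phi: "\<lbrakk>i \<in> {1..n - 1}; (a, b) \<in> \<theta>\<rbrakk> \<Longrightarrow> (\<phi> i a, \<phi> i b) \<in> \<theta>"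
  using \<theta> unfolding congruence_def by blast

lemma congruence_phibar: "\<lbrakk>i \<in> {1..n - 1}; (a, b) \<in> \<theta>\<rbrakk> \<Longrightarrow> (\<phi>bar i a, \<phi>bar i b) \<in> \<theta>"
  using \<theta> unfolding congruence_def by blast

lemma central_kernel_closed:
  "\<zero> \<in> central_kernel \<theta>"
  "\<lbrakk>x \<in> central_kernel \<theta>; y \<in> central_kernel \<theta>\<rbrakk> \<Longrightarrow> x \<curlyvee> y \<in> central_kernel \<theta>"
  using congruence_sup[of "\<zero>" x "\<zero>" y]
  by (auto simp: central_kernel_def central_closed congruence_refl)

lemma central_kernel_phi:
  assumes i: "i \<in> {1..n - 1}" and ab: "(a, b) \<in> \<theta>"
  shows "\<exists>c\<in>central_kernel \<theta>. \<phi> i a \<curlyvee> c = \<phi> i b \<curlyvee> c"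
proof
  \<comment> \<open>The witness is the symmetric difference of \<open>\<phi> i a\<close> and
    \<open>\<phi> i b\<close> in the Boolean centre. Exchanging \<open>a\<close> and
    \<open>b\<close> under \<open>\<phi>bar i\<close> turns both of its terms into
    \<open>\<zero>\<close> modulo \<open>\<theta>\<close>.\<close>
  let ?c = "(\<phi> i a \<curlywedge> \<phi>bar i b) \<curlyvee> (\<phi> i b \<curlywedge> \<phi>bar i a)"
  have "(\<phi> i a \<curlywedge> \<phi>bar i a, \<phi> i a \<curlywedge> \<phi>bar i b) \<in> \<theta>" "(\<phi> i b \<curlywedge> \<phi>bar i b, \<phi> i b \<curlywedge> \<phi>bar i a) \<in> \<theta>"
    by (intro congruence_inf congruence_refl congruence_phibar i ab congruence_sym)+
  then have "(\<zero> \<curlyvee> \<zero>, ?c) \<in> \<theta>"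
    using congruence_sup by (metis phi_inf_phibar[OF i])
  then show "?c \<in> central_kernel \<theta>"
    using phi_central[OF i] phibar_central[OF i] by (simp add: central_kernel_def central_closed)
  show "\<phi> i a \<curlyvee> ?c = \<phi> i b \<curlyvee> ?c"
    by (rule \<sigma>_eq_iff[THEN iffD1]) (auto simp: \<sigma>_def prime_filter_simps phibar_mem_iff[OF i])
qed

text \<open>There are finitely many indices, so the join of their witnesses serves all of them; the
  determination principle then lifts the equations from the \<open>\<phi> i\<close> to
  \<open>a\<close> and \<open>b\<close>.\<close>

lemma central_kernel_witness:
  assumes ab: "(a, b) \<in> \<theta>"
  shows "\<exists>c\<in>central_kernel \<theta>. a \<curlyvee> c = b \<curlyvee> c"
proof -
  \<comment> \<open>Induction on the number of indices treated: enlarging \<open>c\<close> by a join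
    preserves the equations already obtained.\<close>
  have "\<exists>c\<in>central_kernel \<theta>. \<forall>i\<in>{1..m}. \<phi> i a \<curlyvee> c = \<phi> i b \<curlyvee> c" if "m \<le> n - 1" for m
    using that
  proof (induction m)
    case 0
    then show ?case using central_kernel_closed(1) by auto
  next
    case (Suc m)
    then obtain c where c: "c \<in> central_kernel \<theta>" "\<forall>i\<in>{1..m}. \<phi> i a \<curlyvee> c = \<phi> i b \<curlyvee> c" by auto
    obtain d where d: "d \<in> central_kernel \<theta>" "\<phi> (Suc m) a \<curlyvee> d = \<phi> (Suc m) b \<curlyvee> d"
      using central_kernel_phi[OF _ ab, of "Suc m"] Suc.prems by auto
    have "\<phi> i a \<curlyvee> (c \<curlyvee> d) = \<phi> i b \<curlyvee> (c \<curlyvee> d)" if "i \<in> {1..Suc m}" for i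
    proof (cases "i = Suc m")
      case True then show ?thesis using d(2) by (metis sup.assoc sup.commute)
    next
      case False with that c(2) show ?thesis by (metis atLeastAtMost_iff le_Suc_eq sup.assoc)
    qed
    then show ?case using central_kernel_closed(2) c(1) d(1) by blast
  qed
  then obtain c where c: "c \<in> central_kernel \<theta>" "\<forall>i\<in>{1..n - 1}. \<phi> i a \<curlyvee> c = \<phi> i b \<curlyvee> c" by blast
  have "a \<curlyvee> c = b \<curlyvee> c"
  proof (rule phi_determination)
    fix i assume i: "i \<in> {1..n - 1}"
    \<comment> \<open>Centrality of \<open>c\<close> gives
      \<open>\<phi> i (a \<curlyvee> c) = \<phi> i a \<curlyvee> c\<close>, the form handled
      above.\<close>
    then have "\<phi> i c = c" using c(1) by (simp add: central_kernel_def central_def)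
    with i c(2) show "\<phi> i (a \<curlyvee> c) = \<phi> i (b \<curlyvee> c)" by (simp add: phi_sup)
  qed
  with c(1) show ?thesis by blast
qed

lemma congruence_subset_cong_of: "\<theta> \<subseteq> cong_of (\<Union>z\<in>central_kernel \<theta>. \<sigma> z)"
proof (clarify)
  fix a b assume "(a, b) \<in> \<theta>"
  then obtain c where c: "c \<in> central_kernel \<theta>" "(a, b) \<in> cong_of (\<sigma> c)"
    using central_kernel_witness unfolding cong_of_\<sigma>_iff by blast
  then show "(a, b) \<in> cong_of (\<Union>z\<in>central_kernel \<theta>. \<sigma> z)"
    using cong_of_mono[of "\<sigma> c" "\<Union>z\<in>central_kernel \<theta>. \<sigma> z"] by blast
qed

text \<open>Joining with an element congruent to \<open>\<zero>\<close> stays in the same class, so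
  \<open>a\<close> and \<open>b\<close> are linked through
  \<open>a \<curlyvee> c = b \<curlyvee> c\<close>.\<close>

lemma cong_of_subset_congruence:
  assumes "(\<zero>, c) \<in> \<theta>"
  shows "cong_of (\<sigma> c) \<subseteq> \<theta>"
proof (clarify)
  fix a b assume "(a, b) \<in> cong_of (\<sigma> c)"
  then have "a \<curlyvee> c = b \<curlyvee> c" by (simp add: cong_of_\<sigma>_iff)
  moreover have "(x, x \<curlyvee> c) \<in> \<theta>" for x
    using congruence_sup[OF congruence_refl assms] by simp
  ultimately show "(a, b) \<in> \<theta>" by (metis congruence_sym congruence_trans)
qed

end

section \<open>The congruence lattice and its complemented elements\<close>

lemma carrier_congruence_lattice: "carrier (congruence_lattice n \<phi> \<phi>bar) = {\<theta>. congruence n \<phi> \<phi>bar \<theta>}"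
  by (simp add: congruence_lattice_def inclusion_order_def)

lemma le_congruence_lattice: "\<theta> \<sqsubseteq>\<^bsub>congruence_lattice n \<phi> \<phi>bar\<^esub> \<psi> \<longleftrightarrow> \<theta> \<subseteq> \<psi>"
  by (simp add: congruence_lattice_def inclusion_order_def)

lemma congruence_Int:
  assumes "congruence n \<phi> \<phi>bar \<theta>" "congruence n \<phi> \<phi>bar \<psi>"
  shows "congruence n \<phi> \<phi>bar (\<theta> \<inter> \<psi>)"
proof -
  have "equiv UNIV (\<theta> \<inter> \<psi>)"
  proof (rule equivI)
    show "refl (\<theta> \<inter> \<psi>)" using assms congruence_refl by (auto simp: refl_on_def)
    show "sym (\<theta> \<inter> \<psi>)" using assms congruence_sym by (intro symI) blast
    show "trans (\<theta> \<inter> \<psi>)" using assms congruence_trans by (intro transI) blast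
  qed simp
  moreover note assms[THEN congruence_sup] assms[THEN congruence_inf]
    assms[THEN congruence_phi] assms[THEN congruence_phibar]
  ultimately show ?thesis unfolding congruence_def Int_iff by simp
qed

lemma congruence_UNIV: "congruence n \<phi> \<phi>bar UNIV"
  by (auto simp: congruence_def equiv_def refl_on_def sym_def trans_def)

lemma congruence_Id: "congruence n \<phi> \<phi>bar Id"
  by (auto simp: congruence_def equiv_def refl_on_def sym_def trans_def)

lemma bottom_congruence_lattice: "\<bottom>\<^bsub>congruence_lattice n \<phi> \<phi>bar\<^esub> = Id"
proof -
  interpret complete_lattice "congruence_lattice n \<phi> \<phi>bar"
    by (rule complete_lattice_congruence_lattice)
  have "\<bottom>\<^bsub>congruence_lattice n \<phi> \<phi>bar\<^esub> \<subseteq> Id"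
    using bottom_lower[of Id] congruence_Id
    by (simp add: carrier_congruence_lattice le_congruence_lattice)
  moreover have "congruence n \<phi> \<phi>bar \<bottom>\<^bsub>congruence_lattice n \<phi> \<phi>bar\<^esub>"
    using bottom_closed by (simp add: carrier_congruence_lattice)
  ultimately show ?thesis using congruence_refl by blast
qed

lemma top_congruence_lattice: "\<top>\<^bsub>congruence_lattice n \<phi> \<phi>bar\<^esub> = UNIV"
proof -
  interpret complete_lattice "congruence_lattice n \<phi> \<phi>bar"
    by (rule complete_lattice_congruence_lattice)
  have "UNIV \<subseteq> \<top>\<^bsub>congruence_lattice n \<phi> \<phi>bar\<^esub>"
    using top_higher[of UNIV] congruence_UNIV
    by (simp add: carrier_congruence_lattice le_congruence_lattice)
  then show ?thesis by blast
qed

lemma meet_congruence_lattice: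
  assumes "congruence n \<phi> \<phi>bar \<theta>" "congruence n \<phi> \<phi>bar \<psi>"
  shows "\<theta> \<sqinter>\<^bsub>congruence_lattice n \<phi> \<phi>bar\<^esub> \<psi> = \<theta> \<inter> \<psi>"
  unfolding congruence_lattice_def
  by (rule meet_inclusion_order) (use assms congruence_Int in auto)

text \<open>Expressing that a join is the top through common upper bounds avoids any explicit
  description of joins of congruences.\<close>

lemma boolean_congruences_iff:
  "\<theta> \<in> boolean_congruences n \<phi> \<phi>bar \<longleftrightarrow> congruence n \<phi> \<phi>bar \<theta> \<and>
    (\<exists>\<psi>. congruence n \<phi> \<phi>bar \<psi> \<and> \<theta> \<inter> \<psi> = Id \<and>
      (\<forall>\<eta>. congruence n \<phi> \<phi>bar \<eta> \<longrightarrow> \<theta> \<subseteq> \<eta> \<longrightarrow> \<psi> \<subseteq> \<eta> \<longrightarrow> \<eta> = UNIV))"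
proof -
  interpret complete_lattice "congruence_lattice n \<phi> \<phi>bar"
    by (rule complete_lattice_congruence_lattice)
  have join: "\<theta> \<squnion>\<^bsub>congruence_lattice n \<phi> \<phi>bar\<^esub> \<psi> = UNIV \<longleftrightarrow>
      (\<forall>\<eta>. congruence n \<phi> \<phi>bar \<eta> \<longrightarrow> \<theta> \<subseteq> \<eta> \<longrightarrow> \<psi> \<subseteq> \<eta> \<longrightarrow> \<eta> = UNIV)"
    if "congruence n \<phi> \<phi>bar \<theta>" "congruence n \<phi> \<phi>bar \<psi>" for \<psi>
  proof
    assume U: "\<theta> \<squnion>\<^bsub>congruence_lattice n \<phi> \<phi>bar\<^esub> \<psi> = UNIV"
    show "\<forall>\<eta>. congruence n \<phi> \<phi>bar \<eta> \<longrightarrow> \<theta> \<subseteq> \<eta> \<longrightarrow> \<psi> \<subseteq> \<eta> \<longrightarrow> \<eta> = UNIV"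
    proof (intro allI impI)
      fix \<eta> assume "congruence n \<phi> \<phi>bar \<eta>" "\<theta> \<subseteq> \<eta>" "\<psi> \<subseteq> \<eta>"
      then have "\<theta> \<squnion>\<^bsub>congruence_lattice n \<phi> \<phi>bar\<^esub> \<psi> \<subseteq> \<eta>"
        using join_le[of \<theta> \<eta> \<psi>] that
        by (simp add: carrier_congruence_lattice le_congruence_lattice)
      with U show "\<eta> = UNIV" by blast
    qed
  next
    assume "\<forall>\<eta>. congruence n \<phi> \<phi>bar \<eta> \<longrightarrow> \<theta> \<subseteq> \<eta> \<longrightarrow> \<psi> \<subseteq> \<eta> \<longrightarrow> \<eta> = UNIV"
    then show "\<theta> \<squnion>\<^bsub>congruence_lattice n \<phi> \<phi>bar\<^esub> \<psi> = UNIV"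
      unfolding congruence_lattice_def
      by (intro join_inclusion_order) (use that congruence_UNIV in auto)
  qed
  show ?thesis
    unfolding boolean_congruences_def Let_def carrier_congruence_lattice
      bottom_congruence_lattice top_congruence_lattice
    by (simp add: Bex_def meet_congruence_lattice join cong: conj_cong)
qed

section \<open>The correspondence between clopen modal sets and Boolean congruences\<close>

lemma clopen_modal_Un:
  "\<lbrakk>2 \<le> n; G \<in> clopen_modal n \<phi>; H \<in> clopen_modal n \<phi>\<rbrakk> \<Longrightarrow> G \<union> H \<in> clopen_modal n \<phi>"
  by (auto simp: clopen_modal_eq \<sigma>_sup[symmetric] central_closed)

lemma clopen_modal_Int:
  "\<lbrakk>2 \<le> n; G \<in> clopen_modal n \<phi>; H \<in> clopen_modal n \<phi>\<rbrakk> \<Longrightarrow> G \<inter> H \<in> clopen_modal n \<phi>"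
  by (auto simp: clopen_modal_eq \<sigma>_inf[symmetric] central_closed)

lemma clopen_modal_subset: "2 \<le> n \<Longrightarrow> G \<in> clopen_modal n \<phi> \<Longrightarrow> G \<subseteq> prime_filters"
  using \<sigma>_subset by (auto simp: clopen_modal_eq)

lemma clopen_modal_compl:
  "\<lbrakk>2 \<le> n; G \<in> clopen_modal n \<phi>\<rbrakk> \<Longrightarrow> prime_filters - G \<in> clopen_modal n \<phi>"
  using openin_topspace[of spectrum] closedin_topspace[of spectrum]
  by (auto simp: clopen_modal_def modal_compl topspace_spectrum
      intro: openin_diff closedin_diff)

lemma congruence_clopen:
  "\<lbrakk>2 \<le> n; G \<in> clopen_modal n \<phi>\<rbrakk> \<Longrightarrow> congruence n \<phi> \<phi>bar (cong_of G)"
  by (simp add: clopen_modal_def congruence_cong_of)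

text \<open>With \<open>G = \<sigma> z\<close> and \<open>H = \<sigma> w\<close>, the congruence
  \<open>\<eta>\<close> collapses \<open>z\<close> and \<open>w\<close> to \<open>\<zero>\<close>,
  hence also \<open>z \<curlyvee> w\<close>. Since \<open>\<eta>\<close> is an arbitrary congruence,
  this gives joins among all congruences as well as among the Boolean ones.\<close>

lemma cong_of_Un_least:
  assumes n: "2 \<le> n" and G: "G \<in> clopen_modal n \<phi>" and H: "H \<in> clopen_modal n \<phi>"
    and \<eta>: "congruence n \<phi> \<phi>bar \<eta>" "cong_of G \<subseteq> \<eta>" "cong_of H \<subseteq> \<eta>"
  shows "cong_of (G \<union> H) \<subseteq> \<eta>"
proof -
  obtain z w where zw: "G = \<sigma> z" "H = \<sigma> w" using G H by (auto simp: clopen_modal_eq[OF n])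
  have "(\<zero>, z) \<in> \<eta>" "(\<zero>, w) \<in> \<eta>" using \<eta>(2,3) by (auto simp: zw cong_of_\<sigma>_iff)
  then have "(\<zero>, z \<curlyvee> w) \<in> \<eta>" using congruence_sup[OF \<eta>(1), of "\<zero>" z "\<zero>" w] by simp
  then show ?thesis using cong_of_subset_congruence[OF \<eta>(1)] by (simp add: zw flip: \<sigma>_sup)
qed

text \<open>The complement is the congruence of the complementary set: intersections are preserved,
  and an upper bound of both contains the congruence of the whole spectrum.\<close>

lemma cong_of_boolean:
  assumes n: "2 \<le> n" and G: "G \<in> clopen_modal n \<phi>"
  shows "cong_of G \<in> boolean_congruences n \<phi> \<phi>bar"
proof -
  let ?H = "prime_filters - G"
  have "cong_of G \<inter> cong_of ?H = Id"
    by (simp add: cong_of_Int[symmetric] cong_of_empty)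
  moreover have "\<eta> = UNIV"
    if "congruence n \<phi> \<phi>bar \<eta>" "cong_of G \<subseteq> \<eta>" "cong_of ?H \<subseteq> \<eta>" for \<eta>
  proof -
    have "cong_of (G \<union> ?H) \<subseteq> \<eta>"
      by (rule cong_of_Un_least[OF n G clopen_modal_compl[OF n G] that])
    moreover have "cong_of (G \<union> ?H) = UNIV" by (auto simp: cong_of_iff)
    ultimately show ?thesis by blast
  qed
  ultimately show ?thesis
    unfolding boolean_congruences_iff
    using congruence_clopen[OF n G] congruence_clopen[OF n clopen_modal_compl[OF n G]]
    by (intro conjI exI[of _ "cong_of ?H"] allI impI)
qed

lemma boolean_is_cong_of:
  assumes n: "2 \<le> n" and "\<theta> \<in> boolean_congruences n \<phi> \<phi>bar"
  shows "\<exists>G\<in>clopen_modal n \<phi>. \<theta> = cong_of G"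
proof -
  obtain \<psi> where \<theta>: "congruence n \<phi> \<phi>bar \<theta>" and \<psi>: "congruence n \<phi> \<phi>bar \<psi>" and Id: "\<theta> \<inter> \<psi> = Id"
    and UNIV: "\<forall>\<eta>. congruence n \<phi> \<phi>bar \<eta> \<longrightarrow> \<theta> \<subseteq> \<eta> \<longrightarrow> \<psi> \<subseteq> \<eta> \<longrightarrow> \<eta> = UNIV"
    using assms(2) unfolding boolean_congruences_iff by (elim conjE exE) (rule that)
  let ?G = "\<Union>z\<in>central_kernel \<theta>. \<sigma> z" and ?H = "\<Union>z\<in>central_kernel \<psi>. \<sigma> z"
  have "modal n \<phi> ?G" "modal n \<phi> ?H"
    by (rule modal_Union[OF n], auto simp: central_kernel_def)+
  \<comment> \<open>This congruence will lie above both \<open>\<theta>\<close> and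
    \<open>\<psi>\<close>, so complementarity makes it the full relation.\<close>
  then have "congruence n \<phi> \<phi>bar (cong_of (?G \<union> ?H))"
    by (intro congruence_cong_of modal_Un n)
  moreover have "\<theta> \<subseteq> cong_of (?G \<union> ?H)" "\<psi> \<subseteq> cong_of (?G \<union> ?H)"
    by (rule order_trans[OF congruence_subset_cong_of[OF \<theta>] cong_of_mono[OF Un_upper1]],
        rule order_trans[OF congruence_subset_cong_of[OF \<psi>] cong_of_mono[OF Un_upper2]])
  ultimately have "cong_of (?G \<union> ?H) = UNIV" by (rule UNIV[rule_format])
  \<comment> \<open>Every prime filter separates \<open>\<zero>\<close> from \<open>\<one>\<close>,
    so relating the two forces the sets to cover the spectrum.\<close>
  then have "(\<zero>, \<one>) \<in> cong_of (?G \<union> ?H)" by blast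
  then have "prime_filters \<subseteq> ?G \<union> ?H" unfolding cong_of_def by (simp add: \<sigma>_top \<sigma>_bot)
  then obtain c d where "c \<in> central_kernel \<theta>" "d \<in> central_kernel \<psi>" and cd: "c \<curlyvee> d = \<one>"
    using prime_filter_cover[of "central_kernel \<theta>" "central_kernel \<psi>"] central_kernel_closed[OF \<theta>] central_kernel_closed[OF \<psi>]
    by blast
  then have c: "c \<in> central" "(\<zero>, c) \<in> \<theta>" and d: "(\<zero>, d) \<in> \<psi>"
    by (auto simp: central_kernel_def)
  have "\<theta> \<subseteq> cong_of (\<sigma> c)"
  proof clarify
    fix a b assume "(a, b) \<in> \<theta>"
    then have "(a \<curlyvee> c, b \<curlyvee> c) \<in> \<theta>" by (intro congruence_sup congruence_refl \<theta>)
    \<comment> \<open>Modulo \<open>\<psi>\<close>, \<open>d\<close> is \<open>\<zero>\<close>, so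
      \<open>c\<close> agrees with \<open>c \<curlyvee> d = \<one>\<close>. Joining with
      \<open>c\<close> thus sends everything to the \<open>\<psi>\<close>-class of
      \<open>\<one>\<close>, and \<open>\<theta> \<inter> \<psi> = Id\<close> yields
      equality.\<close>
    moreover have "(c, \<one>) \<in> \<psi>"
      using congruence_sup[OF \<psi> congruence_refl[OF \<psi>, of c] d] by (simp add: cd)
    then have "(x \<curlyvee> c, \<one>) \<in> \<psi>" for x
      using congruence_sup[OF \<psi> congruence_refl[OF \<psi>, of x], of c "\<one>"] by simp
    then have "(a \<curlyvee> c, b \<curlyvee> c) \<in> \<psi>" using congruence_sym[OF \<psi>] congruence_trans[OF \<psi>] by blast
    ultimately have "a \<curlyvee> c = b \<curlyvee> c" using Id by blast
    then show "(a, b) \<in> cong_of (\<sigma> c)" by (simp add: cong_of_\<sigma>_iff)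
  qed
  then have "\<theta> = cong_of (\<sigma> c)" using cong_of_subset_congruence[OF \<theta> c(2)] by blast
  then show ?thesis using c(1) by (auto simp: clopen_modal_eq[OF n])
qed

lemma boolean_congruences_eq:
  "2 \<le> n \<Longrightarrow> boolean_congruences n \<phi> \<phi>bar = cong_of ` clopen_modal n \<phi>"
  using cong_of_boolean boolean_is_cong_of by blast

text \<open>For \<open>G = \<sigma> z\<close>, the test pair \<open>(\<zero>, z)\<close> has
  symmetric difference exactly \<open>G\<close>. This makes \<open>cong_of\<close> injective on
  clopen modal sets.\<close>

lemma cong_of_clopen_subset:
  assumes "2 \<le> n" "G \<in> clopen_modal n \<phi>" "cong_of G \<subseteq> cong_of H"
  shows "G \<subseteq> H"
proof -
  obtain z where z: "G = \<sigma> z" using assms(1,2) by (auto simp: clopen_modal_eq)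
  then have "(\<zero>, z) \<in> cong_of H" using assms(3) by (auto simp: cong_of_\<sigma>_iff)
  then show ?thesis by (auto simp: cong_of_def z \<sigma>_bot)
qed

section \<open>The two sublattices and the isomorphism\<close>

lemma sublattice_clopen_modal:
  assumes n: "2 \<le> n"
  shows "sublattice (clopen_modal n \<phi>) (inclusion_order (Pow (topspace (spectrum :: 'a set topology))))"
proof -
  let ?X = "prime_filters :: 'a set set"
  have "lattice (inclusion_order (Pow ?X))"
  proof (rule lattice_inclusion_order)
    fix A B assume "A \<in> Pow ?X" "B \<in> Pow ?X"
    then show "\<exists>J\<in>Pow ?X. A \<subseteq> J \<and> B \<subseteq> J \<and> (\<forall>C\<in>Pow ?X. A \<subseteq> C \<longrightarrow> B \<subseteq> C \<longrightarrow> J \<subseteq> C)"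
      by (intro bexI[of _ "A \<union> B"]) auto
    show "\<exists>M\<in>Pow ?X. M \<subseteq> A \<and> M \<subseteq> B \<and> (\<forall>C\<in>Pow ?X. C \<subseteq> A \<longrightarrow> C \<subseteq> B \<longrightarrow> C \<subseteq> M)"
      using \<open>A \<in> Pow ?X\<close> by (intro bexI[of _ "A \<inter> B"]) auto
  qed
  moreover have "G \<squnion>\<^bsub>inclusion_order (Pow ?X)\<^esub> H = G \<union> H" "G \<sqinter>\<^bsub>inclusion_order (Pow ?X)\<^esub> H = G \<inter> H"
    if "G \<in> clopen_modal n \<phi>" "H \<in> clopen_modal n \<phi>" for G H
    using clopen_modal_subset[OF n that(1)] clopen_modal_subset[OF n that(2)]
    by (intro join_inclusion_order meet_inclusion_order; auto)+
  moreover have "clopen_modal n \<phi> \<noteq> {}"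
    using central_closed(1) by (auto simp: clopen_modal_eq[OF n])
  moreover have "clopen_modal n \<phi> \<subseteq> carrier (inclusion_order (Pow ?X))"
    using clopen_modal_subset[OF n] by (auto simp: inclusion_order_def)
  ultimately show ?thesis
    unfolding sublattice_def topspace_spectrum
    using clopen_modal_Un[OF n] clopen_modal_Int[OF n] by simp
qed

lemma sublattice_boolean_congruences:
  assumes n: "2 \<le> n"
  shows "sublattice (boolean_congruences n \<phi> \<phi>bar) (congruence_lattice n \<phi> \<phi>bar)"
proof -
  let ?L = "congruence_lattice n \<phi> \<phi>bar"
  interpret complete_lattice ?L by (rule complete_lattice_congruence_lattice)
  \<comment> \<open>These operations are taken among all congruences; their values show that the
    Boolean ones are closed under them.\<close>
  have eqs: "cong_of G \<squnion>\<^bsub>?L\<^esub> cong_of H = cong_of (G \<union> H)"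
      "cong_of G \<sqinter>\<^bsub>?L\<^esub> cong_of H = cong_of (G \<inter> H)"
    if G: "G \<in> clopen_modal n \<phi>" and H: "H \<in> clopen_modal n \<phi>" for G H
  proof -
    show "cong_of G \<squnion>\<^bsub>?L\<^esub> cong_of H = cong_of (G \<union> H)"
      unfolding congruence_lattice_def
      by (rule join_inclusion_order)
        (use congruence_clopen[OF n] G H clopen_modal_Un[OF n G H] cong_of_Un_least[OF n G H]
          cong_of_mono[OF Un_upper1] cong_of_mono[OF Un_upper2] in simp_all)
    show "cong_of G \<sqinter>\<^bsub>?L\<^esub> cong_of H = cong_of (G \<inter> H)"
      by (simp add: cong_of_Int meet_congruence_lattice congruence_clopen n G H)
  qed
  have "lattice ?L" ..
  moreover have "clopen_modal n \<phi> \<noteq> {}"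
    using central_closed(1) by (auto simp: clopen_modal_eq[OF n])
  ultimately show ?thesis
    unfolding sublattice_def boolean_congruences_eq[OF n] carrier_congruence_lattice
    by (simp add: eqs image_subset_iff congruence_clopen[OF n] clopen_modal_Un[OF n]
        clopen_modal_Int[OF n])
qed

text \<open>Both structures are bare families ordered by inclusion, so their joins and meets are
  computed anew inside each family. On the Boolean side they are transported from unions and
  intersections of sets.\<close>

lemma lattice_iso_cong_of:
  assumes n: "2 \<le> n"
  shows "lattice_iso (inclusion_order (clopen_modal n \<phi>))
    (inclusion_order (boolean_congruences n \<phi> \<phi>bar)) cong_of"
proof -
  let ?C = "clopen_modal n \<phi>" and ?B = "boolean_congruences n \<phi> \<phi>bar"
  note Un = clopen_modal_Un[OF n] and Int = clopen_modal_Int[OF n]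
  note least = cong_of_Un_least[OF n] and B = boolean_congruences_eq[OF n]
  note cong = congruence_clopen[OF n]
  have C: "lattice (inclusion_order ?C)"
  proof (rule lattice_inclusion_order)
    fix G H assume GH: "G \<in> ?C" "H \<in> ?C"
    show "\<exists>J\<in>?C. G \<subseteq> J \<and> H \<subseteq> J \<and> (\<forall>K\<in>?C. G \<subseteq> K \<longrightarrow> H \<subseteq> K \<longrightarrow> J \<subseteq> K)"
      by (rule bexI[of _ "G \<union> H"]) (use Un[OF GH] in auto)
    show "\<exists>M\<in>?C. M \<subseteq> G \<and> M \<subseteq> H \<and> (\<forall>K\<in>?C. K \<subseteq> G \<longrightarrow> K \<subseteq> H \<longrightarrow> K \<subseteq> M)"
      by (rule bexI[of _ "G \<inter> H"]) (use Int[OF GH] in auto)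
  qed
  have lub: "cong_of (G \<union> H) \<in> ?B" "cong_of G \<subseteq> cong_of (G \<union> H)" "cong_of H \<subseteq> cong_of (G \<union> H)"
    "\<And>\<eta>. \<lbrakk>\<eta> \<in> ?B; cong_of G \<subseteq> \<eta>; cong_of H \<subseteq> \<eta>\<rbrakk> \<Longrightarrow> cong_of (G \<union> H) \<subseteq> \<eta>"
    and glb: "cong_of (G \<inter> H) \<in> ?B" "cong_of (G \<inter> H) \<subseteq> cong_of G" "cong_of (G \<inter> H) \<subseteq> cong_of H"
    "\<And>\<eta>. \<lbrakk>\<eta> \<in> ?B; \<eta> \<subseteq> cong_of G; \<eta> \<subseteq> cong_of H\<rbrakk> \<Longrightarrow> \<eta> \<subseteq> cong_of (G \<inter> H)"
    if GH: "G \<in> ?C" "H \<in> ?C" for G H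
  proof -
    show "cong_of (G \<union> H) \<in> ?B" "cong_of (G \<inter> H) \<in> ?B" using Un[OF GH] Int[OF GH] B by auto
    show "cong_of (G \<union> H) \<subseteq> \<eta>" if "\<eta> \<in> ?B" "cong_of G \<subseteq> \<eta>" "cong_of H \<subseteq> \<eta>" for \<eta>
      using least[OF GH] that by (simp add: boolean_congruences_iff)
  qed (simp_all add: cong_of_Int cong_of_mono)
  have L: "lattice (inclusion_order ?B)"
  proof (rule lattice_inclusion_order)
    fix \<theta> \<psi> assume "\<theta> \<in> ?B" "\<psi> \<in> ?B"
    then obtain G H where GH: "G \<in> ?C" "H \<in> ?C" and eq: "\<theta> = cong_of G" "\<psi> = cong_of H"
      by (auto simp: B)
    show "\<exists>J\<in>?B. \<theta> \<subseteq> J \<and> \<psi> \<subseteq> J \<and> (\<forall>\<eta>\<in>?B. \<theta> \<subseteq> \<eta> \<longrightarrow> \<psi> \<subseteq> \<eta> \<longrightarrow> J \<subseteq> \<eta>)"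
      unfolding eq by (intro bexI[of _ "cong_of (G \<union> H)"] conjI ballI impI lub[OF GH])
    show "\<exists>M\<in>?B. M \<subseteq> \<theta> \<and> M \<subseteq> \<psi> \<and> (\<forall>\<eta>\<in>?B. \<eta> \<subseteq> \<theta> \<longrightarrow> \<eta> \<subseteq> \<psi> \<longrightarrow> \<eta> \<subseteq> M)"
      unfolding eq by (intro bexI[of _ "cong_of (G \<inter> H)"] conjI ballI impI glb[OF GH])
  qed
  have carrier: "carrier (inclusion_order S) = S" for S :: "'c set set"
    by (simp add: inclusion_order_def)
  \<comment> \<open>Surjectivity is the description of \<open>?B\<close> as an image; injectivity is
    order reflection applied in both directions.\<close>
  have bij: "bij_betw cong_of ?C ?B"
    unfolding bij_betw_def B
    by (intro conjI inj_onI equalityI cong_of_clopen_subset[OF n]) simp_all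
  have join: "cong_of (G \<squnion>\<^bsub>inclusion_order ?C\<^esub> H) = cong_of G \<squnion>\<^bsub>inclusion_order ?B\<^esub> cong_of H"
    if GH: "G \<in> ?C" "H \<in> ?C" for G H
  proof -
    have "G \<squnion>\<^bsub>inclusion_order ?C\<^esub> H = G \<union> H"
      by (rule join_inclusion_order) (use GH Un[OF GH] in auto)
    moreover have "cong_of G \<squnion>\<^bsub>inclusion_order ?B\<^esub> cong_of H = cong_of (G \<union> H)"
      by (rule join_inclusion_order(2)[OF lub[OF GH]]) (use GH B in auto)
    ultimately show ?thesis by simp
  qed
  have meet: "cong_of (G \<sqinter>\<^bsub>inclusion_order ?C\<^esub> H) = cong_of G \<sqinter>\<^bsub>inclusion_order ?B\<^esub> cong_of H"
    if GH: "G \<in> ?C" "H \<in> ?C" for G H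
  proof -
    have "G \<sqinter>\<^bsub>inclusion_order ?C\<^esub> H = G \<inter> H"
      by (rule meet_inclusion_order) (use GH Int[OF GH] in auto)
    moreover have "cong_of G \<sqinter>\<^bsub>inclusion_order ?B\<^esub> cong_of H = cong_of (G \<inter> H)"
      by (rule meet_inclusion_order(2)[OF glb[OF GH]]) (use GH B in auto)
    ultimately show ?thesis by simp
  qed
  show ?thesis
    unfolding lattice_iso_def join_pres_def meet_pres_def carrier
    using C L bij join meet by simp
qed

end

theorem theorem4p22:
  fixes n :: nat
    and \<phi> \<phi>bar :: "nat \<Rightarrow> 'a::{bounded_lattice, distrib_lattice} \<Rightarrow> 'a"
  assumes "2 \<le> n"
    and "LM_algebra n \<phi> \<phi>bar"
  shows "sublattice (clopen_modal n \<phi>)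
           (inclusion_order (Pow (topspace (spectrum :: 'a set topology)))) \<and>
         sublattice (boolean_congruences n \<phi> \<phi>bar) (congruence_lattice n \<phi> \<phi>bar) \<and>
         lattice_iso
           (inclusion_order (clopen_modal n \<phi>))
           (inclusion_order (boolean_congruences n \<phi> \<phi>bar))
           (\<lambda>G. {(a, b). sym_diff (\<sigma> b) (\<sigma> a) \<subseteq> G})"
proof -
  interpret LM_algebra n \<phi> \<phi>bar by (rule assms(2))
  have eq: "cong_of = (\<lambda>G. {(a, b :: 'a). sym_diff (\<sigma> b) (\<sigma> a) \<subseteq> G})"
    by (intro ext) (rule cong_of_def)
  show ?thesis
    using sublattice_clopen_modal sublattice_boolean_congruences lattice_iso_cong_of[unfolded eq]
      assms(1)
    by (intro conjI)
qed

end
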